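(* Let $V$ be a vector space of countably infinite dimension over $\mathbb{Q}$, let $\mu_V=\{(x,y,z)\in V^3: 2y=x+z\}$, and let $\mathcal{M}_V=(V,\mu_V)$ be the midpoint structure associated with $V$. Then: (1) $\mathcal{M}_V$ is age indivisible. (2) $\mathcal{M}_V$ is not weakly indivisible. (3) $\mathcal{M}_V$ is universal for its age: every countable relational structure $\mathcal{R}=(R,\mu')$ with one ternary relation $\mu'\subseteq R^3$ and with the same age as $\mathcal{M}_V$ is embeddable into $\mathcal{M}_V$, i.e. is isomorphic to an induced substructure of $\mathcal{M}_V$.
   Context: The age of a relational structure $\mathcal{R}$ with base set $R$, denoted $\mathrm{age}(\mathcal{R})$, is the class of finite relational structures isomorphic to an induced substructure of $\mathcal{R}$ on a nonempty finite subset of $R$. For $A\subseteq R$, $\mathcal{R}{\restriction}A$ is the induced substructure on $A$. An embedding of $\mathcal{R}$ into $\mathcal{R}'$ is an isomorphism of $\mathcal{R}$ onto an induced substructure of $\mathcal{R}'$; $\mathrm{Emb}(\mathcal{R})$ is the set of embeddings of $\mathcal{R}$ into itself. $\mathcal{R}$ is age indivisible if for every partition $(P_0,P_1)$ of $R$ there is $i\in\{0,1\}$ with $\mathrm{age}(\mathcal{R}{\restriction}P_i)=\mathrm{age}(\mathcal{R})$. $\mathcal{R}$ is weakly indivisible if for every partition $(P_0,P_1)$ of $R$ with $\mathrm{age}(\mathcal{R}{\restriction}P_0)\neq\mathrm{age}(\mathcal{R})$ there exists $\epsilon\in\mathrm{Emb}(\mathcal{R})$ with $\epsilon[R]\subseteq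 P_1$. *)

theory Defs
  imports Complex_Main "HOL-Library.Countable_Set"
begin

text \<open>Relational structures in the signature consisting of a single ternary relation.\<close>

record 'a ternary_structure =
  base :: "'a set"
  trel :: "('a \<times> 'a \<times> 'a) set"

definition is_structure :: "'a ternary_structure \<Rightarrow> bool" where
  "is_structure R \<longleftrightarrow> trel R \<subseteq> base R \<times> base R \<times> base R"

definition induced :: "'a ternary_structure \<Rightarrow> 'a set \<Rightarrow> 'a ternary_structure" where
  "induced R A = \<lparr>base = A, trel = trel R \<inter> (A \<times> A \<times> A)\<rparr>"

definition isomorphism ::
  "('a \<Rightarrow> 'b) \<Rightarrow> 'a ternary_structure \<Rightarrow> 'b ternary_structure \<Rightarrow> bool" where
  "isomorphism f R S \<longleftrightarrow> bij_betw f (base R) (base S) \<and>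
     (\<forall>x\<in>base R. \<forall>y\<in>base R. \<forall>z\<in>base R.
        (x, y, z) \<in> trel R \<longleftrightarrow> (f x, f y, f z) \<in> trel S)"

definition isomorphic :: "'a ternary_structure \<Rightarrow> 'b ternary_structure \<Rightarrow> bool" where
  "isomorphic R S \<longleftrightarrow> (\<exists>f. isomorphism f R S)"

text \<open>Functions are total; only the values of an embedding on the base set matter.\<close>

definition embedding ::
  "('a \<Rightarrow> 'b) \<Rightarrow> 'a ternary_structure \<Rightarrow> 'b ternary_structure \<Rightarrow> bool" where
  "embedding f R S \<longleftrightarrow> (\<exists>A. A \<subseteq> base S \<and> isomorphism f R (induced S A))"

definition Emb :: "'a ternary_structure \<Rightarrow> ('a \<Rightarrow> 'a) set" where
  "Emb R = {f. embedding f R R}"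

definition embeddable :: "'a ternary_structure \<Rightarrow> 'b ternary_structure \<Rightarrow> bool" where
  "embeddable R S \<longleftrightarrow> (\<exists>f. embedding f R S)"

text \<open>The age is a class of finite structures closed under isomorphism. It is represented by
  its members with base set a set of natural numbers: every finite structure has an isomorphic
  copy of this kind, so two ages coincide iff their representations do. The representation
  also makes ages of structures over different types comparable.\<close>

definition age :: "'a ternary_structure \<Rightarrow> nat ternary_structure set" where
  "age R = {F. is_structure F \<and> finite (base F) \<and>
     (\<exists>A. A \<subseteq> base R \<and> finite A \<and> A \<noteq> {} \<and> isomorphic F (induced R A))}"

definition is_bipartition :: "'a set \<Rightarrow> 'a set \<Rightarrow> 'a set \<Rightarrow> bool" where
  "is_bipartition P0 P1 X \<longleftrightarrow> P0 \<union> P1 = X \<and> P0 \<inter> P1 = {}"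

definition age_indivisible :: "'a ternary_structure \<Rightarrow> bool" where
  "age_indivisible R \<longleftrightarrow>
     (\<forall>P0 P1. is_bipartition P0 P1 (base R) \<longrightarrow>
        age (induced R P0) = age R \<or> age (induced R P1) = age R)"

definition weakly_indivisible :: "'a ternary_structure \<Rightarrow> bool" where
  "weakly_indivisible R \<longleftrightarrow>
     (\<forall>P0 P1. is_bipartition P0 P1 (base R) \<and> age (induced R P0) \<noteq> age R \<longrightarrow>
        (\<exists>\<epsilon>\<in>Emb R. \<epsilon> ` base R \<subseteq> P1))"

definition countably_infinite_dim :: "(rat \<Rightarrow> 'v::ab_group_add \<Rightarrow> 'v) \<Rightarrow> bool" where
  "countably_infinite_dim scale \<longleftrightarrow>
     (\<exists>B. countable B \<and> infinite B \<and>
        \<not> module.dependent scale B \<and> module.span scale B = UNIV)"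

definition midpoint_structure ::
  "(rat \<Rightarrow> 'v::ab_group_add \<Rightarrow> 'v) \<Rightarrow> 'v ternary_structure" where
  "midpoint_structure scale =
     \<lparr>base = UNIV, trel = {(x, y, z). scale 2 y = x + z}\<rparr>"

end

theory Submission
  imports Defs "HOL-Library.FuncSet" "HOL-Library.Function_Algebras"
begin

text \<open>
  \<^emph>\<open>Age indivisibility.\<close> A homothety \<open>x \<mapsto> a + d x\<close> with \<open>d > 0\<close> is injective and respects
  midpoints in both directions, so homothetic copies of a finite set induce isomorphic structures.
  If neither part of a bipartition had the full age, there would be finite sets \<open>A0\<close> and \<open>A1\<close>
  without a copy in the first and in the second part, respectively. But Gallai's theorem, the
  generalization of van der Waerden's theorem to arbitrary finite sets, puts a homothetic copy of
  \<open>A0 \<union> A1\<close> inside one of the two parts. Gallai's theorem is proved here by colour focusing.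

  \<^emph>\<open>Failure of weak indivisibility.\<close> An injective midpoint-preserving map sends the progression
  \<open>0, v, 2v, \<dots>\<close> to an infinite arithmetic progression. There are only countably many of these in
  \<open>V\<close>, so a greedy construction gives a set \<open>P\<close> that meets all of them but contains no three distinct
  points one of which is the midpoint of the others. Since \<open>P\<close> contains no copy of \<open>{0, v, 2v}\<close>, it
  does not have the full age, while its complement contains the image of no self-embedding.

  \<^emph>\<open>Universality.\<close> Given \<open>R\<close>, consider the rational vector space with the points of \<open>R\<close> as a basis,
  and its subspace \<open>N\<close> spanned by the vectors \<open>2 y - x - z\<close> for \<open>(x, y, z)\<close> in the relation. The
  quotient by \<open>N\<close> has countable dimension, hence embeds into \<open>V\<close>; the composed map from \<open>R\<close> to \<open>V\<close>
  takes related triples to midpoints. It creates no coincidences and no further midpoints: a vector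
  lies in \<open>N\<close> on account of finitely many related triples, and an embedding of the finitely many
  points involved, which exists because the ages agree, extends to a linear map that vanishes
  on these triples but separates points and unrelated triples.
\<close>

section \<open>Ages of ternary structures\<close>

lemma age_induced_subset: "P \<subseteq> base R \<Longrightarrow> age (induced R P) \<subseteq> age R"
proof
  fix F assume P: "P \<subseteq> base R" and "F \<in> age (induced R P)"
  then obtain A where F: "is_structure F" "finite (base F)" and A: "A \<subseteq> P" "finite A" "A \<noteq> {}"
    "isomorphic F (induced (induced R P) A)"
    by (auto simp: age_def induced_def)
  have "induced (induced R P) A = induced R A"
    using A(1) by (auto simp: induced_def)
  moreover have "A \<subseteq> base R" using A(1) P by blast
  ultimately show "F \<in> age R" using F A(2-4) unfolding age_def by auto
qed

lemma isomorphism_trans: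
  assumes "isomorphism f R S" "isomorphism g S T"
  shows "isomorphism (g \<circ> f) R T"
proof -
  have "f x \<in> base S" if "x \<in> base R" for x
    using assms(1) that by (auto simp: isomorphism_def bij_betw_def)
  then show ?thesis
    using assms bij_betw_trans unfolding isomorphism_def by (simp, blast)
qed

lemma isomorphism_inv:
  assumes "isomorphism f R S"
  shows "isomorphism (inv_into (base R) f) S R"
proof -
  let ?g = "inv_into (base R) f"
  have b: "bij_betw f (base R) (base S)" using assms by (simp add: isomorphism_def)
  have "?g y \<in> base R" "f (?g y) = y" if "y \<in> base S" for y
    using b that by (auto simp: bij_betw_def inv_into_into f_inv_into_f)
  with assms b show ?thesis
    by (auto simp: isomorphism_def bij_betw_inv_into)
qed

text \<open>The age only has members on sets of natural numbers; transporting the finite structure to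
  such a set and back makes the inclusion usable for structures on arbitrary types.\<close>

lemma finite_substructure_of_age_subset:
  assumes "age R \<subseteq> age S" "A \<subseteq> base R" "finite A" "A \<noteq> {}"
  shows "\<exists>A' f. A' \<subseteq> base S \<and> isomorphism f (induced R A) (induced S A')"
proof -
  obtain e :: "'a \<Rightarrow> nat" where e: "inj_on e A"
    using finite_imp_inj_to_nat_seg[OF assms(3)] by metis
  define F where "F = \<lparr>base = e ` A, trel = (\<lambda>(x, y, z). (e x, e y, e z)) ` (trel R \<inter> A \<times> A \<times> A)\<rparr>"
  have iso: "isomorphism e (induced R A) F"
    unfolding isomorphism_def
  proof (intro conjI ballI)
    fix x y z assume "x \<in> base (induced R A)" "y \<in> base (induced R A)" "z \<in> base (induced R A)"
    then have A: "x \<in> A" "y \<in> A" "z \<in> A" by (simp_all add: induced_def)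
    have "(x, y, z) \<in> trel R" if "(e x, e y, e z) \<in> trel F"
    proof -
      from that obtain x' y' z' where "(x', y', z') \<in> trel R" "x' \<in> A" "y' \<in> A" "z' \<in> A"
        "e x = e x'" "e y = e y'" "e z = e z'" by (auto simp: F_def)
      with A e show ?thesis by (metis inj_onD)
    qed
    with A show "(x, y, z) \<in> trel (induced R A) \<longleftrightarrow> (e x, e y, e z) \<in> trel F"
      by (force simp: F_def induced_def)
  qed (use e in \<open>simp add: F_def induced_def bij_betw_def\<close>)
  have "isomorphic F (induced R A)"
    using isomorphism_inv[OF iso] by (auto simp: isomorphic_def)
  then have "F \<in> age R"
    using assms by (auto simp: age_def is_structure_def F_def)
  then have "F \<in> age S" using assms(1) by blast
  then obtain A' g where "A' \<subseteq> base S" "isomorphism g F (induced S A')"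
    by (auto simp: age_def isomorphic_def)
  then show ?thesis using isomorphism_trans[OF iso] by blast
qed

section \<open>Monochromatic homothetic copies\<close>

locale rational_vector_space = vector_space scale
  for scale :: "rat \<Rightarrow> 'v::ab_group_add \<Rightarrow> 'v"
begin

abbreviation M where "M \<equiv> midpoint_structure scale"

lemma scale_two: "scale 2 x = x + x"
  by (metis one_add_one scale_left_distrib scale_one)

text \<open>A homothety is given by its translation vector and its ratio.\<close>

definition homothety :: "'v \<times> rat \<Rightarrow> 'v \<Rightarrow> 'v" where
  "homothety h x = fst h + scale (snd h) x"

definition monochromatic_copy :: "('v \<Rightarrow> nat) \<Rightarrow> ('v \<times> rat) set \<Rightarrow> 'v set \<Rightarrow> bool" where
  "monochromatic_copy c H S \<longleftrightarrow> (\<exists>h\<in>H. \<exists>k. \<forall>x\<in>S. c (homothety h x) = k)"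

text \<open>Asking for one finite set of homotheties that serves all colourings is the compact form of the
  theorem. It is needed because the induction colours points by the colour patterns of translates
  of a finite window, and there are only finitely many patterns if the window is finite.\<close>

definition gallai :: "'v set \<Rightarrow> nat \<Rightarrow> bool" where
  "gallai S r \<longleftrightarrow> (\<exists>H. finite H \<and> (\<forall>h\<in>H. snd h > 0) \<and>
     (\<forall>c. (\<forall>x. c x < r) \<longrightarrow> monochromatic_copy c H S))"

text \<open>The copies of \<open>S\<close> have pairwise different colours \<open>C\<close>, and the point \<open>s\<close>, missing from each of
  them, would be at the same place \<open>f\<close> in all: whichever colour from \<open>C\<close> the focus \<open>f\<close> has, it
  completes one of the copies.\<close>

definition focused :: "('v \<Rightarrow> nat) \<Rightarrow> ('v \<times> rat) set \<Rightarrow> 'v set \<Rightarrow> 'v \<Rightarrow> 'v \<Rightarrow> nat set \<Rightarrow> bool" where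
  "focused c H S s f C \<longleftrightarrow>
     (\<forall>k\<in>C. \<exists>h\<in>H. homothety h s = f \<and> (\<forall>x\<in>S. c (homothety h x) = k))"

text \<open>Translates of the window \<open>X\<close> have finitely many colour patterns. Numbering the patterns turns
  the map from base points to patterns into a colouring.\<close>

lemma gallai_windows:
  assumes "\<And>m. gallai S m" "finite X"
  shows "\<exists>H. finite H \<and> (\<forall>h\<in>H. snd h > 0) \<and>
    (\<forall>c::'v \<Rightarrow> nat. (\<forall>x. c x < r) \<longrightarrow>
      (\<exists>h\<in>H. \<forall>s\<in>S. \<forall>t\<in>S. \<forall>x\<in>X. c (homothety h s + x) = c (homothety h t + x)))"
proof -
  let ?D = "X \<rightarrow>\<^sub>E {..<r}"
  have "finite ?D" using assms(2) by (intro finite_PiE) auto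
  then obtain e where e: "bij_betw e ?D {0..<card ?D}"
    using ex_bij_betw_finite_nat by blast
  obtain H where H: "finite H" "\<forall>h\<in>H. snd h > 0"
    "\<And>c. (\<forall>x. c x < card ?D) \<Longrightarrow> monochromatic_copy c H S"
    using assms(1)[of "card ?D"] unfolding gallai_def by blast
  have "\<exists>h\<in>H. \<forall>s\<in>S. \<forall>t\<in>S. \<forall>x\<in>X. c (homothety h s + x) = c (homothety h t + x)"
    if c: "\<forall>x. c x < r" for c :: "'v \<Rightarrow> nat"
  proof -
    define w where "w v = (\<lambda>x\<in>X. c (v + x))" for v
    have w: "w v \<in> ?D" for v using c by (auto simp: w_def)
    then have "\<forall>v. e (w v) < card ?D" using e by (fastforce simp: bij_betw_def)
    from H(3)[OF this] obtain h k where h: "h \<in> H" "\<And>x. x \<in> S \<Longrightarrow> e (w (homothety h x)) = k"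
      unfolding monochromatic_copy_def by blast
    have "c (homothety h s + x) = c (homothety h t + x)" if "s \<in> S" "t \<in> S" "x \<in> X" for s t x
    proof -
      have "w (homothety h s) = w (homothety h t)"
        using e h(2)[OF that(1)] h(2)[OF that(2)] w by (metis bij_betw_def inj_onD)
      from fun_cong[OF this, of x] show ?thesis using that(3) by (simp add: w_def)
    qed
    with h(1) show ?thesis by blast
  qed
  with H(1,2) show ?thesis by blast
qed

text \<open>Each step adds one colour to the focused copies. A large copy of \<open>S\<close> is chosen such that the
  window \<open>X\<close> of the previous step looks the same at all its points. If the window has \<open>j\<close> copies
  focused at \<open>f\<close>, then combining the large homothety with each of them by addition gives \<open>j\<close> copies
  of unchanged colours, because each of their points lies in a different but equally coloured
  window. The translates of \<open>f\<close> in the windows form one more copy, of the colour of \<open>f\<close>, and all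
  \<open>j + 1\<close> copies are focused at the translate of \<open>f\<close> in the window at \<open>s\<close>.\<close>

lemma gallai_focusing:
  assumes IH: "\<And>m. gallai S m" and S: "finite S" "s0 \<in> S"
  shows "\<exists>X H. finite X \<and> finite H \<and> (\<forall>h\<in>H. snd h > 0 \<and> homothety h ` insert s S \<subseteq> X) \<and>
    (\<forall>c. (\<forall>x. c x < r) \<longrightarrow> monochromatic_copy c H (insert s S) \<or>
      (\<exists>f\<in>X. \<exists>C\<subseteq>{..<r}. card C = j \<and> focused c H S s f C))"
proof (induction j)
  case 0
  show ?case by (rule exI[of _ "{0}"], rule exI[of _ "{}"]) (auto simp: focused_def)
next
  case (Suc j)
  from Suc.IH obtain X H where X: "finite X" and H: "finite H"
    and HX: "\<forall>h\<in>H. snd h > 0 \<and> homothety h ` insert s S \<subseteq> X"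
    and foc: "\<And>c. (\<forall>x. c x < r) \<Longrightarrow> monochromatic_copy c H (insert s S) \<or>
      (\<exists>f\<in>X. \<exists>C\<subseteq>{..<r}. card C = j \<and> focused c H S s f C)"
    by blast
  obtain G where G: "finite G" "\<forall>g\<in>G. snd g > 0"
    "\<And>c::'v \<Rightarrow> nat. (\<forall>x. c x < r) \<Longrightarrow>
      \<exists>g\<in>G. \<forall>t\<in>S. \<forall>u\<in>S. \<forall>x\<in>X. c (homothety g t + x) = c (homothety g u + x)"
    using gallai_windows[OF IH X, of r] by blast
  \<comment> \<open>\<open>H1\<close>: a copy of \<open>insert s S\<close> found inside a window; \<open>H2\<close>: the focused copies spread over the
    windows; \<open>H3\<close>: the translates of the focus.\<close>
  define H1 where "H1 = (\<lambda>(g, h). (homothety g s0 + fst h, snd h)) ` (G \<times> H)"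
  define H2 where "H2 = (\<lambda>(g, h). (fst g + fst h, snd g + snd h)) ` (G \<times> H)"
  define H3 where "H3 = (\<lambda>(g, f). (fst g + f, snd g)) ` (G \<times> X)"
  define H' where "H' = H1 \<union> H2 \<union> H3"
  define X' where "X' = (\<Union>h\<in>H'. homothety h ` insert s S)"
  have finH: "finite H'" using G H X by (simp add: H'_def H1_def H2_def H3_def)
  then have finX: "finite X'" using S by (simp add: X'_def)
  have HX': "\<forall>h\<in>H'. snd h > 0 \<and> homothety h ` insert s S \<subseteq> X'"
  proof
    fix h assume h: "h \<in> H'"
    then have "snd h > 0"
      using HX G(2) by (fastforce simp: H'_def H1_def H2_def H3_def intro: add_pos_pos)
    with h show "snd h > 0 \<and> homothety h ` insert s S \<subseteq> X'" by (auto simp: X'_def)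
  qed
  have "\<forall>c. (\<forall>x. c x < r) \<longrightarrow> monochromatic_copy c H' (insert s S) \<or>
      (\<exists>f\<in>X'. \<exists>C\<subseteq>{..<r}. card C = Suc j \<and> focused c H' S s f C)"
  proof (intro allI impI)
    fix c :: "'v \<Rightarrow> nat" assume c: "\<forall>x. c x < r"
    let ?mono = "monochromatic_copy c H' (insert s S)"
    let ?foc = "\<exists>f\<in>X'. \<exists>C\<subseteq>{..<r}. card C = Suc j \<and> focused c H' S s f C"
    obtain g where g: "g \<in> G"
      and win: "\<And>t x. t \<in> S \<Longrightarrow> x \<in> X \<Longrightarrow> c (homothety g t + x) = c (homothety g s0 + x)"
      using G(3)[OF c] S(2) by blast
    \<comment> \<open>All windows look alike, so the one at \<open>s0\<close> represents them.\<close>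
    define c' where "c' v = c (homothety g s0 + v)" for v
    have c': "\<forall>x. c' x < r" using c by (simp add: c'_def)
    have mono: ?mono if "h \<in> H" "\<forall>x\<in>insert s S. c' (homothety h x) = k" for h k
    proof -
      have "(homothety g s0 + fst h, snd h) \<in> H'" using g that(1) by (force simp: H'_def H1_def)
      moreover have "\<forall>x\<in>insert s S. c (homothety (homothety g s0 + fst h, snd h) x) = k"
        using that(2) by (simp add: c'_def homothety_def add.assoc)
      ultimately show ?mono unfolding monochromatic_copy_def by blast
    qed
    from foc[OF c'] show "?mono \<or> ?foc"
    proof
      assume "monochromatic_copy c' H (insert s S)"
      then show ?thesis using mono unfolding monochromatic_copy_def by blast
    next
      assume "\<exists>f\<in>X. \<exists>C\<subseteq>{..<r}. card C = j \<and> focused c' H S s f C"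
      then obtain f C where f: "f \<in> X" and C: "C \<subseteq> {..<r}" "card C = j"
        and foc': "\<And>k. k \<in> C \<Longrightarrow> \<exists>h\<in>H. homothety h s = f \<and> (\<forall>x\<in>S. c' (homothety h x) = k)"
        unfolding focused_def by blast
      show ?thesis
      proof (cases "c' f \<in> C")
        case True
        from foc'[OF this] obtain h where "h \<in> H" "homothety h s = f" "\<forall>x\<in>S. c' (homothety h x) = c' f"
          by blast
        then have ?mono by (intro mono[of h "c' f"]) auto
        then show ?thesis ..
      next
        case False
        let ?f = "homothety g s + f"
        have new: "\<exists>h\<in>H'. homothety h s = ?f \<and> (\<forall>x\<in>S. c (homothety h x) = k)"
          if k: "k \<in> insert (c' f) C" for k
        proof (cases "k = c' f")
          case True
          have "(fst g + f, snd g) \<in> H'" using g f by (force simp: H'_def H3_def)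
          moreover have "homothety (fst g + f, snd g) x = homothety g x + f" for x
            by (simp add: homothety_def algebra_simps)
          moreover have "c (homothety g x + f) = k" if "x \<in> S" for x
            using win[OF that f] True by (simp add: c'_def)
          ultimately show ?thesis by (intro bexI[of _ "(fst g + f, snd g)"]) auto
        next
          case False
          then obtain h where h: "h \<in> H" "homothety h s = f" "\<forall>x\<in>S. c' (homothety h x) = k"
            using foc' k by blast
          have "(fst g + fst h, snd g + snd h) \<in> H'" using g h by (force simp: H'_def H2_def)
          moreover have "homothety (fst g + fst h, snd g + snd h) x = homothety g x + homothety h x" for x
            by (simp add: homothety_def scale_left_distrib algebra_simps)
          moreover have "c (homothety g x + homothety h x) = k" if "x \<in> S" for x
            using win[OF that, of "homothety h x"] HX h(1,3) that by (auto simp: c'_def)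
          ultimately show ?thesis using h(2)
            by (intro bexI[of _ "(fst g + fst h, snd g + snd h)"]) auto
        qed
        have "homothety h s \<in> X'" if "h \<in> H'" for h
          using that by (auto simp: X'_def)
        then have "?f \<in> X'" using new[of "c' f"] by fastforce
        moreover have "insert (c' f) C \<subseteq> {..<r}" using C c' by auto
        moreover have "card (insert (c' f) C) = Suc j"
          using False C finite_subset[OF C(1)] by simp
        moreover have "focused c H' S s ?f (insert (c' f) C)"
          using new unfolding focused_def by blast
        ultimately have ?foc by blast
        then show ?thesis ..
      qed
    qed
  qed
  with finH finX HX' show ?case
    by (intro exI[of _ X'] exI[of _ H'] conjI)
qed

text \<open>With \<open>r\<close> colours there cannot be \<open>r + 1\<close> focused copies of different colours, so the focusing
  lemma for \<open>j = r + 1\<close> leaves only the monochromatic copy.\<close>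

theorem gallai_finite: "finite S \<Longrightarrow> gallai S r"
proof (induction S arbitrary: r rule: finite_induct)
  case empty
  show ?case unfolding gallai_def monochromatic_copy_def by (rule exI[of _ "{(0, 1)}"]) auto
next
  case (insert s S r)
  show ?case
  proof (cases "S = {}")
    case True
    then show ?thesis unfolding gallai_def monochromatic_copy_def by (intro exI[of _ "{(0, 1)}"]) auto
  next
    case False
    then obtain s0 where "s0 \<in> S" by blast
    from gallai_focusing[OF insert.IH insert.hyps(1) this, of s r "Suc r"]
    obtain X H where H: "finite H" "\<forall>h\<in>H. snd h > 0"
      and foc: "\<And>c. (\<forall>x. c x < r) \<Longrightarrow> monochromatic_copy c H (insert s S) \<or>
        (\<exists>f\<in>X. \<exists>C\<subseteq>{..<r}. card C = Suc r \<and> focused c H S s f C)"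
      by blast
    have "\<not> (C \<subseteq> {..<r} \<and> card C = Suc r)" for C
      using card_mono[of "{..<r}" C] by auto
    then have "monochromatic_copy c H (insert s S)" if "\<forall>x. c x < r" for c
      using foc[OF that] by blast
    with H show ?thesis unfolding gallai_def by (intro exI[of _ H] conjI allI impI)
  qed
qed

section \<open>Age indivisibility\<close>

lemma homothety_isomorphism:
  assumes "snd h > 0"
  shows "isomorphism (homothety h) (induced M A) (induced M (homothety h ` A))"
proof -
  have inj: "inj (homothety h)"
    using assms by (auto simp: inj_def homothety_def)
  have "scale 2 (homothety h y) - (homothety h x + homothety h z)
      = scale (snd h) (scale 2 y - (x + z))" for x y z
    by (simp add: homothety_def algebra_simps flip: scale_left_distrib)
       (metis (no_types) add.assoc add.commute one_add_one scale_left_distrib scale_one)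
  then have "scale 2 (homothety h y) = homothety h x + homothety h z \<longleftrightarrow> scale 2 y = x + z" for x y z
    using assms by (metis eq_iff_diff_eq_0 less_numeral_extra(3) scale_eq_0_iff)
  with inj show ?thesis
    by (auto simp: isomorphism_def induced_def midpoint_structure_def bij_betw_def intro: inj_on_subset)
qed

text \<open>Gallai's theorem for two colours is applied to the union of two finite sets, each of which would
  be missing from one of the parts.\<close>

theorem midpoint_age_indivisible: "age_indivisible M"
  unfolding age_indivisible_def
proof (intro allI impI)
  fix P0 P1 assume "is_bipartition P0 P1 (base M)"
  then have P: "P0 \<union> P1 = UNIV" by (auto simp: is_bipartition_def midpoint_structure_def)
  show "age (induced M P0) = age M \<or> age (induced M P1) = age M"
  proof (rule ccontr)
    assume "\<not> ?thesis"
    moreover have "age (induced M P) \<subseteq> age M" for P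
      by (rule age_induced_subset) (simp add: midpoint_structure_def)
    ultimately obtain F0 F1 where F: "F0 \<in> age M" "F0 \<notin> age (induced M P0)"
      "F1 \<in> age M" "F1 \<notin> age (induced M P1)" by blast
    have copy: "\<exists>A. finite A \<and> (\<forall>h P. snd h > 0 \<longrightarrow> homothety h ` A \<subseteq> P \<longrightarrow> F \<in> age (induced M P))"
      if "F \<in> age M" for F
    proof -
      from that obtain A f where F: "is_structure F" "finite (base F)" and A: "finite A" "A \<noteq> {}"
        and f: "isomorphism f F (induced M A)"
        by (auto simp: age_def isomorphic_def)
      have "F \<in> age (induced M P)" if "snd h > 0" "homothety h ` A \<subseteq> P" for h P
      proof -
        have "induced (induced M P) (homothety h ` A) = induced M (homothety h ` A)"
          using that(2) by (auto simp: induced_def)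
        then have "isomorphic F (induced (induced M P) (homothety h ` A))"
          using isomorphism_trans[OF f homothety_isomorphism[OF that(1)]] by (auto simp: isomorphic_def)
        with F A that(2) show ?thesis
          unfolding age_def by (auto simp: induced_def intro!: exI[of _ "homothety h ` A"])
      qed
      with A show ?thesis by blast
    qed
    obtain A0 where A0: "finite A0" "\<And>h P. snd h > 0 \<Longrightarrow> homothety h ` A0 \<subseteq> P \<Longrightarrow> F0 \<in> age (induced M P)"
      using copy[OF F(1)] by blast
    obtain A1 where A1: "finite A1" "\<And>h P. snd h > 0 \<Longrightarrow> homothety h ` A1 \<subseteq> P \<Longrightarrow> F1 \<in> age (induced M P)"
      using copy[OF F(3)] by blast
    define c :: "'v \<Rightarrow> nat" where "c x = (if x \<in> P0 then 0 else 1)" for x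
    have "gallai (A0 \<union> A1) 2" using A0 A1 by (simp add: gallai_finite)
    moreover have "\<forall>x. c x < 2" by (simp add: c_def)
    ultimately obtain h k where h: "snd h > 0" "\<And>x. x \<in> A0 \<union> A1 \<Longrightarrow> c (homothety h x) = k"
      unfolding gallai_def monochromatic_copy_def by blast
    show False
    proof (cases "k = 0")
      case True
      with h(2) have "c (homothety h x) = 0" if "x \<in> A0" for x using that by simp
      then have "homothety h ` A0 \<subseteq> P0" by (force simp: c_def split: if_splits)
      then show False using A0(2) h(1) F(2) by blast
    next
      case False
      with h(2) have "c (homothety h x) \<noteq> 0" if "x \<in> A1" for x using that by simp
      then have "homothety h ` A1 \<subseteq> - P0" by (force simp: c_def split: if_splits)
      with P have "homothety h ` A1 \<subseteq> P1" by blast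
      then show False using A1(2) h(1) F(4) by blast
    qed
  qed
qed

section \<open>Failure of weak indivisibility\<close>

definition midpoint_free :: "'v set \<Rightarrow> bool" where
  "midpoint_free A \<longleftrightarrow> (\<forall>x\<in>A. \<forall>y\<in>A. \<forall>z\<in>A. scale 2 y = x + z \<longrightarrow> x = z)"

text \<open>A new point \<open>p\<close> only has to avoid finitely many values: \<open>2 y - z\<close>, where \<open>p\<close> would be an endpoint,
  and \<open>(x + z) / 2\<close>, where it would be the midpoint.\<close>

lemma midpoint_free_extend:
  assumes "midpoint_free A" "finite A" "infinite L"
  shows "\<exists>p\<in>L. midpoint_free (insert p A)"
proof -
  let ?B = "(\<lambda>(y, z). scale 2 y - z) ` (A \<times> A) \<union> (\<lambda>(x, z). scale (1/2) (x + z)) ` (A \<times> A)"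
  have "finite ?B" using assms(2) by simp
  then obtain p where p: "p \<in> L" "p \<notin> ?B"
    using assms(3) by (meson finite_subset subsetI)
  have 1: "scale 2 y \<noteq> p + z" "scale 2 y \<noteq> z + p" if "y \<in> A" "z \<in> A" for y z
  proof -
    have "p \<noteq> scale 2 y - z" using p(2) that by auto
    then show "scale 2 y \<noteq> p + z" "scale 2 y \<noteq> z + p" by (auto simp: algebra_simps)
  qed
  have 2: "scale 2 p \<noteq> x + z" if "x \<in> A" "z \<in> A" for x z
  proof
    assume "scale 2 p = x + z"
    then have "p = scale (1/2) (x + z)" by (metis (no_types, lifting) scale_scale scale_one
        nonzero_eq_divide_eq zero_neq_numeral)
    then show False using p(2) that by auto
  qed
  have 3: "scale 2 p = p + z \<Longrightarrow> p = z" "scale 2 p = z + p \<Longrightarrow> z = p" for z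
    by (auto simp: scale_two)
  show ?thesis
    using p(1) assms(1) 1 2 3 unfolding midpoint_free_def by (metis insert_iff)
qed

lemma midpoint_free_transversal:
  fixes L :: "nat \<Rightarrow> 'v set"
  assumes "\<And>n. infinite (L n)"
  shows "\<exists>P. midpoint_free P \<and> (\<forall>n. P \<inter> L n \<noteq> {})"
proof -
  have "\<exists>A. \<forall>n. (finite (A n) \<and> midpoint_free (A n)) \<and> (A n \<subseteq> A (Suc n) \<and> A (Suc n) \<inter> L n \<noteq> {})"
  proof (rule dependent_nat_choice)
    show "\<exists>A. finite A \<and> midpoint_free A" by (rule exI[of _ "{}"]) (simp add: midpoint_free_def)
  next
    fix A :: "'v set" and n assume A: "finite A \<and> midpoint_free A"
    then obtain p where "p \<in> L n" "midpoint_free (insert p A)"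
      using midpoint_free_extend assms by blast
    with A show "\<exists>B. (finite B \<and> midpoint_free B) \<and> A \<subseteq> B \<and> B \<inter> L n \<noteq> {}"
      by (intro exI[of _ "insert p A"]) auto
  qed
  then obtain A where A: "\<And>n. midpoint_free (A n)" "\<And>n. A n \<subseteq> A (Suc n)" "\<And>n. A (Suc n) \<inter> L n \<noteq> {}"
    by blast
  have mono: "m \<le> n \<Longrightarrow> A m \<subseteq> A n" for m n
    using A(2) by (rule lift_Suc_mono_le)
  have "midpoint_free (\<Union>n. A n)"
    unfolding midpoint_free_def
  proof (intro ballI impI)
    fix x y z assume "x \<in> (\<Union>n. A n)" "y \<in> (\<Union>n. A n)" "z \<in> (\<Union>n. A n)" and mid: "scale 2 y = x + z"
    then obtain i j k where "x \<in> A i" "y \<in> A j" "z \<in> A k" by blast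
    then have "x \<in> A (max i (max j k))" "y \<in> A (max i (max j k))" "z \<in> A (max i (max j k))"
      using mono by (meson in_mono max.cobounded1 max.cobounded2 max.coboundedI2)+
    then show "x = z" using A(1) mid unfolding midpoint_free_def by blast
  qed
  with A(3) show ?thesis by (intro exI[of _ "\<Union>n. A n"]) blast
qed

lemma countable_span: "countable B \<Longrightarrow> countable (span B)"
proof -
  assume B: "countable B"
  let ?v = "\<lambda>l. \<Sum>(q, b)\<leftarrow>l. scale q b"
  have "span B \<subseteq> ?v ` lists (UNIV \<times> B)"
  proof
    fix x assume "x \<in> span B"
    then show "x \<in> ?v ` lists (UNIV \<times> B)"
    proof (induction rule: span_induct_alt)
      case base
      show ?case by (rule image_eqI[of _ _ "[]"]) auto
    next
      case (step q b y)
      then obtain l where "l \<in> lists (UNIV \<times> B)" "y = ?v l" by blast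
      with step show ?case by (intro image_eqI[of _ _ "(q, b) # l"]) auto
    qed
  qed
  moreover have "countable (lists ((UNIV :: rat set) \<times> B))" using B by auto
  ultimately show ?thesis by (meson countable_image countable_subset)
qed

lemma infinite_progression:
  assumes "d \<noteq> 0"
  shows "infinite (range (\<lambda>n. a + scale (of_nat n) d))"
  using assms by (intro range_inj_infinite) (auto simp: inj_def)

text \<open>Self-embeddings are in fact affine, but it is enough to follow the multiples of a vector, since
  each of them is the midpoint of its two neighbours.\<close>

lemma embedding_progression:
  assumes "f \<in> Emb M"
  shows "f (scale (of_nat n) v) = f 0 + scale (of_nat n) (f v - f 0)"
proof -
  have mid: "scale 2 (f y) = f x + f z" if "scale 2 y = x + z" for x y z
    using assms that by (auto simp: Emb_def embedding_def isomorphism_def induced_def midpoint_structure_def)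
  define d where "d = f v - f 0"
  have step: "scale (of_nat (Suc n)) d = scale (of_nat n) d + d" for n
    by (simp add: scale_left_distrib add.commute)
  show ?thesis
  proof (induction n rule: induct_nat_012)
    case (ge2 n)
    have "scale 2 (f (scale (of_nat (Suc n)) v))
        = f (scale (of_nat n) v) + f (scale (of_nat (Suc (Suc n))) v)"
      by (rule mid) (simp flip: scale_left_distrib)
    then have "f (scale (of_nat (Suc (Suc n))) v)
        = scale 2 (f 0 + scale (of_nat (Suc n)) d) - (f 0 + scale (of_nat n) d)"
      using ge2 by (simp add: d_def)
    also have "\<dots> = f 0 + scale (of_nat (Suc (Suc n))) d"
      by (simp add: scale_two step del: of_nat_Suc)
    finally show ?case by (simp add: d_def)
  qed auto
qed

text \<open>The witness is a midpoint-free set that meets every infinite arithmetic progression: its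
  complement contains no image of a self-embedding.\<close>

theorem midpoint_not_weakly_indivisible:
  assumes "countable (UNIV :: 'v set)" "(v :: 'v) \<noteq> 0"
  shows "\<not> weakly_indivisible M"
proof
  assume wi: "weakly_indivisible M"
  define D where "D = (UNIV :: 'v set) \<times> (UNIV - {0 :: 'v})"
  define L where "L = (\<lambda>p. range (\<lambda>n. fst p + scale (of_nat n) (snd p)))"
  have D: "countable D" "D \<noteq> {}" using assms by (auto simp: D_def intro: countable_subset)
  have "infinite (L (from_nat_into D n))" for n
    using from_nat_into[OF D(2), of n] infinite_progression by (auto simp: L_def D_def)
  then obtain P where P: "midpoint_free P" "\<And>n. P \<inter> L (from_nat_into D n) \<noteq> {}"
    using midpoint_free_transversal[of "\<lambda>n. L (from_nat_into D n)"] by blast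
  have meets: "P \<inter> L (a, d) \<noteq> {}" if "d \<noteq> 0" for a d
    using P(2)[of "to_nat_on D (a, d)"] that D by (simp add: D_def)
  have "age (induced M P) \<noteq> age M"
  proof
    assume "age (induced M P) = age M"
    then obtain A f where "A \<subseteq> P" and f: "isomorphism f (induced M {0, v, scale 2 v}) (induced (induced M P) A)"
      using finite_substructure_of_age_subset[of M "induced M P" "{0, v, scale 2 v}"]
      by (auto simp: induced_def midpoint_structure_def)
    then have "f 0 \<in> P" "f v \<in> P" "f (scale 2 v) \<in> P" "scale 2 (f v) = f 0 + f (scale 2 v)"
      "f 0 \<noteq> f (scale 2 v)"
      using assms(2) by (auto simp: isomorphism_def induced_def midpoint_structure_def bij_betw_def)
    with P(1) show False unfolding midpoint_free_def by blast
  qed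
  moreover have "is_bipartition P (- P) (base M)"
    by (simp add: is_bipartition_def midpoint_structure_def)
  ultimately have "\<exists>f\<in>Emb M. f ` base M \<subseteq> - P"
    using wi unfolding weakly_indivisible_def by blast
  then obtain f where f: "f \<in> Emb M" "range f \<subseteq> - P"
    by (auto simp: midpoint_structure_def)
  have "f v \<noteq> f 0"
    using f(1) assms(2)
    by (auto simp: Emb_def embedding_def isomorphism_def midpoint_structure_def bij_betw_def inj_def)
  then obtain n where "f 0 + scale (of_nat n) (f v - f 0) \<in> P"
    using meets[of "f v - f 0" "f 0"] by (auto simp: L_def)
  then have "f (scale (of_nat n) v) \<in> P" using embedding_progression[OF f(1)] by simp
  with f(2) show False by blast
qed

section \<open>Universality\<close>

lemma embeddingI_midpoint:
  assumes "inj_on f (base R)"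
    and "\<And>x y z. x \<in> base R \<Longrightarrow> y \<in> base R \<Longrightarrow> z \<in> base R \<Longrightarrow>
      (x, y, z) \<in> trel R \<longleftrightarrow> scale 2 (f y) = f x + f z"
  shows "embedding f R M"
  unfolding embedding_def
  using assms
  by (intro exI[of _ "f ` base R"])
     (auto simp: isomorphism_def induced_def midpoint_structure_def bij_betw_def)

end

context vector_space_pair
begin

text \<open>This replaces embedding the quotient of \<open>span E\<close> by \<open>span T\<close>: a basis of \<open>span T\<close> is extended by
  vectors from \<open>E\<close>; the basis of \<open>span T\<close> is sent to zero, and the countably many additional vectors
  are sent injectively to independent ones.\<close>

lemma linear_with_kernel:
  assumes "T \<subseteq> vs1.span E" "countable E" "infinite B" "vs2.independent B"
  shows "\<exists>\<Lambda>. Vector_Spaces.linear s1 s2 \<Lambda> \<and> (\<forall>u\<in>vs1.span E. \<Lambda> u = 0 \<longleftrightarrow> u \<in> vs1.span T)"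
proof -
  obtain K where K: "K \<subseteq> T" "vs1.independent K" "T \<subseteq> vs1.span K"
    using vs1.maximal_independent_subset[of T] by blast
  obtain D where D: "K \<subseteq> D" "D \<subseteq> K \<union> E" "vs1.independent D" "K \<union> E \<subseteq> vs1.span D"
    using vs1.maximal_independent_subset_extend[of K "K \<union> E"] K(2) by blast
  define C where "C = D - K"
  have C: "countable C" "vs1.independent C" "D = K \<union> C"
    using D assms(2) vs1.independent_mono[OF D(3)] by (auto simp: C_def intro: countable_subset)
  obtain B' where B': "B' \<subseteq> B" "countable B'" "infinite B'"
    using infinite_countable_subset'[OF assms(3)] by blast
  define j where "j = from_nat_into B' \<circ> to_nat_on C"
  have j: "inj_on j C" "j ` C \<subseteq> B"
    using B' C(1) inj_on_to_nat_on[OF C(1)] from_nat_into[of B']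
    by (auto simp: j_def inj_on_def from_nat_into_inj_infinite)
  obtain \<Lambda> where \<Lambda>: "Vector_Spaces.linear s1 s2 \<Lambda>" "\<And>x. x \<in> D \<Longrightarrow> \<Lambda> x = (if x \<in> K then 0 else j x)"
    using linear_independent_extend[OF D(3), of "\<lambda>x. if x \<in> K then 0 else j x"] by blast
  interpret \<Lambda>: Vector_Spaces.linear s1 s2 \<Lambda> by (fact \<Lambda>(1))
  have \<Lambda>C: "\<Lambda> x = j x" if "x \<in> C" for x using \<Lambda>(2) that by (auto simp: C_def)
  have K0: "\<Lambda> u = 0" if "u \<in> vs1.span K" for u
  proof (rule \<Lambda>.eq_0_on_span[OF _ that])
    fix x assume "x \<in> K"
    with D(1) show "\<Lambda> x = 0" using \<Lambda>(2)[of x] by auto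
  qed
  have TK: "vs1.span T = vs1.span K"
    using K by (meson subset_antisym vs1.span_minimal vs1.span_mono vs1.subspace_span)
  have "\<Lambda> ` C = j ` C" "inj_on \<Lambda> C" using \<Lambda>C j(1) by (auto simp: inj_on_def)
  moreover have "vs2.independent (j ` C)" using vs2.independent_mono[OF assms(4)] j(2) by blast
  ultimately have inj: "inj_on \<Lambda> (vs1.span C)" using \<Lambda>.inj_on_span_iff_independent_image by simp
  have "\<Lambda> u = 0 \<longleftrightarrow> u \<in> vs1.span T" if "u \<in> vs1.span E" for u
  proof
    assume u: "\<Lambda> u = 0"
    have "u \<in> vs1.span (K \<union> C)"
      using that D(4) C(3) by (metis Un_subset_iff subsetD vs1.span_minimal vs1.subspace_span)
    then obtain x y where xy: "u = x + y" "x \<in> vs1.span K" "y \<in> vs1.span C"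
      by (auto simp: vs1.span_Un)
    then have "\<Lambda> y = \<Lambda> 0" using u K0 by (simp add: \<Lambda>.add)
    from inj_onD[OF inj this xy(3) vs1.span_zero] have "y = 0" .
    with xy TK show "u \<in> vs1.span T" by simp
  qed (simp add: TK K0)
  with \<Lambda>(1) show ?thesis by blast
qed

end

text \<open>The functions \<open>'r \<Rightarrow> rat\<close> form a vector space that contains the one freely generated by the points
  of type \<open>'r\<close>. Its vector \<open>midpoint_vec (x, y, z)\<close> expresses the defect of \<open>y\<close> as midpoint
  of \<open>x\<close> and \<open>z\<close>.\<close>

definition fscale :: "rat \<Rightarrow> ('r \<Rightarrow> rat) \<Rightarrow> 'r \<Rightarrow> rat" where
  "fscale q u = (\<lambda>x. q * u x)"

definition unit_vec :: "'r \<Rightarrow> 'r \<Rightarrow> rat" where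
  "unit_vec x = (\<lambda>y. if y = x then 1 else 0)"

definition midpoint_vec :: "'r \<times> 'r \<times> 'r \<Rightarrow> 'r \<Rightarrow> rat" where
  "midpoint_vec = (\<lambda>(x, y, z). fscale 2 (unit_vec y) - unit_vec x - unit_vec z)"

interpretation fs: vector_space "fscale :: rat \<Rightarrow> ('r \<Rightarrow> rat) \<Rightarrow> _"
  by standard (auto simp: fscale_def fun_eq_iff algebra_simps)

context rational_vector_space
begin

interpretation fp: vector_space_pair "fscale :: rat \<Rightarrow> ('r \<Rightarrow> rat) \<Rightarrow> _" scale ..

lemma linear_weighted_sum:
  assumes "finite A"
  shows "\<exists>\<phi>. Vector_Spaces.linear fscale scale \<phi> \<and> (\<forall>x\<in>A. \<phi> (unit_vec x) = g x)"
proof -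
  let ?\<phi> = "\<lambda>u. \<Sum>x\<in>A. scale (u x) (g x)"
  have "Vector_Spaces.linear fscale scale ?\<phi>"
    by unfold_locales
      (auto simp: fscale_def scale_left_distrib sum.distrib scale_sum_right)
  moreover have "\<forall>y\<in>A. ?\<phi> (unit_vec y) = g y"
  proof
    fix y assume "y \<in> A"
    have "?\<phi> (unit_vec y) = (\<Sum>x\<in>A. if x = y then g x else 0)"
      by (rule sum.cong) (auto simp: unit_vec_def)
    then show "?\<phi> (unit_vec y) = g y" using \<open>y \<in> A\<close> assms by simp
  qed
  ultimately show ?thesis by blast
qed

text \<open>The vector \<open>u\<close> is a combination of finitely many triples. An embedding of their points and of
  \<open>X\<close> into \<open>V\<close> extends linearly to a map that annihilates the vectors of these triples, hence \<open>u\<close>.\<close>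

lemma local_linear_model:
  fixes R :: "'r ternary_structure"
  assumes "age R \<subseteq> age M" "is_structure R" "u \<in> fs.span (midpoint_vec ` trel R)"
    and "X \<subseteq> base R" "finite X" "X \<noteq> {}"
  obtains \<phi> where "Vector_Spaces.linear fscale scale \<phi>" "\<phi> u = 0"
    "inj_on (\<lambda>x. \<phi> (unit_vec x)) X"
    "\<And>x y z. x \<in> X \<Longrightarrow> y \<in> X \<Longrightarrow> z \<in> X \<Longrightarrow>
      (x, y, z) \<in> trel R \<longleftrightarrow> \<phi> (midpoint_vec (x, y, z)) = 0"
proof -
  obtain U r where U: "finite U" "U \<subseteq> midpoint_vec ` trel R" and u: "u = (\<Sum>w\<in>U. fscale (r w) w)"
    using assms(3) by (auto simp: fs.span_explicit)
  obtain T where T: "finite T" "T \<subseteq> trel R" "U = midpoint_vec ` T"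
    using finite_subset_image[OF U] by metis
  define A where "A = X \<union> (\<Union>(x, y, z)\<in>T. {x, y, z})"
  have A: "finite A" "A \<noteq> {}" "A \<subseteq> base R" "X \<subseteq> A"
    using assms T(1,2) by (auto simp: A_def is_structure_def)
  from finite_substructure_of_age_subset[OF assms(1) A(3,1,2)]
  obtain A' g where g: "isomorphism g (induced R A) (induced M A')" by blast
  then have inj: "inj_on g A"
    by (simp add: isomorphism_def induced_def bij_betw_def)
  have mid: "(x, y, z) \<in> trel R \<longleftrightarrow> scale 2 (g y) = g x + g z" if "x \<in> A" "y \<in> A" "z \<in> A" for x y z
    using g that by (auto simp: isomorphism_def induced_def midpoint_structure_def bij_betw_def)
  obtain \<phi> where \<phi>: "Vector_Spaces.linear fscale scale \<phi>" "\<And>x. x \<in> A \<Longrightarrow> \<phi> (unit_vec x) = g x"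
    using linear_weighted_sum[OF A(1), of g] by blast
  interpret \<phi>: Vector_Spaces.linear fscale scale \<phi> by (fact \<phi>(1))
  have rel: "(x, y, z) \<in> trel R \<longleftrightarrow> \<phi> (midpoint_vec (x, y, z)) = 0"
    if "x \<in> A" "y \<in> A" "z \<in> A" for x y z
    using mid[OF that] that
    by (simp add: midpoint_vec_def \<phi>.diff \<phi>.add \<phi>.scale \<phi>(2) diff_diff_eq)
  have "\<phi> w = 0" if "w \<in> U" for w
  proof -
    from that T(3) obtain x y z where "w = midpoint_vec (x, y, z)" "(x, y, z) \<in> T"
      by (metis image_iff surj_pair)
    moreover from this(2) have "x \<in> A" "y \<in> A" "z \<in> A" by (force simp: A_def)+
    ultimately show ?thesis using rel T(2) by blast
  qed
  then have "\<phi> u = 0" by (simp add: u \<phi>.sum \<phi>.scale)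
  moreover have "inj_on (\<lambda>x. \<phi> (unit_vec x)) X"
    using inj A(4) \<phi>(2) by (auto simp: inj_on_def subset_iff)
  moreover have "(x, y, z) \<in> trel R \<longleftrightarrow> \<phi> (midpoint_vec (x, y, z)) = 0"
    if "x \<in> X" "y \<in> X" "z \<in> X" for x y z
    using rel A(4) that by blast
  ultimately show ?thesis by (rule that[OF \<phi>(1)])
qed

text \<open>The map \<open>\<Lambda>\<close> annihilates exactly the consequences of the relation, and the local models show
  that neither \<open>x = y\<close> for distinct points nor an unrelated midpoint triple is among them.\<close>

theorem midpoint_universal:
  fixes R :: "'r ternary_structure"
  assumes B: "infinite B" "independent B"
    and R: "is_structure R" "countable (base R)" "age R \<subseteq> age M"
  shows "embeddable R M"
proof -
  let ?T = "midpoint_vec ` trel R" and ?E = "unit_vec ` base R"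
  have E: "unit_vec x \<in> fs.span ?E" if "x \<in> base R" for x
    using that by (simp add: fs.span_base)
  have vec: "midpoint_vec (x, y, z) \<in> fs.span ?E" if "x \<in> base R" "y \<in> base R" "z \<in> base R" for x y z
    using E that by (simp add: midpoint_vec_def fs.span_diff fs.span_scale)
  have "?T \<subseteq> fs.span ?E"
    using R(1) vec by (auto simp: is_structure_def)
  then obtain \<Lambda> where \<Lambda>: "Vector_Spaces.linear fscale scale \<Lambda>"
    "\<And>u. u \<in> fs.span ?E \<Longrightarrow> \<Lambda> u = 0 \<longleftrightarrow> u \<in> fs.span ?T"
    using fp.linear_with_kernel[of ?T ?E B] B R(2) by blast
  interpret \<Lambda>: Vector_Spaces.linear fscale scale \<Lambda> by (fact \<Lambda>(1))
  let ?f = "\<lambda>x. \<Lambda> (unit_vec x)"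
  have "embedding ?f R M"
  proof (rule embeddingI_midpoint)
    show "inj_on ?f (base R)"
    proof (rule inj_onI)
      fix x y assume xy: "x \<in> base R" "y \<in> base R" and "?f x = ?f y"
      then have "\<Lambda> (unit_vec x - unit_vec y) = 0" by (simp add: \<Lambda>.diff)
      then have "unit_vec x - unit_vec y \<in> fs.span ?T"
        using \<Lambda>(2) E xy fs.span_diff by blast
      then obtain \<phi> where \<phi>: "Vector_Spaces.linear fscale scale \<phi>" "\<phi> (unit_vec x - unit_vec y) = 0"
        "inj_on (\<lambda>x. \<phi> (unit_vec x)) {x, y}"
        by (rule local_linear_model[OF R(3,1), of _ "{x, y}"]) (use xy in simp_all)
      then have "\<phi> (unit_vec x) = \<phi> (unit_vec y)"
        using fp.linear_diff by fastforce
      from inj_onD[OF \<phi>(3) this] show "x = y" by simp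
    qed
  next
    fix x y z assume xyz: "x \<in> base R" "y \<in> base R" "z \<in> base R"
    have "scale 2 (?f y) = ?f x + ?f z \<longleftrightarrow> \<Lambda> (midpoint_vec (x, y, z)) = 0"
      by (simp add: midpoint_vec_def \<Lambda>.diff \<Lambda>.add \<Lambda>.scale diff_diff_eq)
    also have "\<dots> \<longleftrightarrow> midpoint_vec (x, y, z) \<in> fs.span ?T"
      using \<Lambda>(2) vec xyz by blast
    also have "\<dots> \<longleftrightarrow> (x, y, z) \<in> trel R"
    proof
      assume "midpoint_vec (x, y, z) \<in> fs.span ?T"
      then show "(x, y, z) \<in> trel R"
        by (rule local_linear_model[OF R(3,1), of _ "{x, y, z}"]) (use xyz in simp_all)
    qed (simp add: fs.span_base)
    finally show "(x, y, z) \<in> trel R \<longleftrightarrow> scale 2 (?f y) = ?f x + ?f z" by blast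
  qed
  then show ?thesis unfolding embeddable_def by blast
qed

end

theorem theorem19:
  fixes scale :: "rat \<Rightarrow> 'v::ab_group_add \<Rightarrow> 'v"
  assumes "vector_space scale"
    and "countably_infinite_dim scale"
  shows "age_indivisible (midpoint_structure scale) \<and>
    \<not> weakly_indivisible (midpoint_structure scale) \<and>
    (\<forall>R :: 'r ternary_structure.
       is_structure R \<and> countable (base R) \<and> age R = age (midpoint_structure scale) \<longrightarrow>
       embeddable R (midpoint_structure scale))"
proof -
  interpret rational_vector_space scale
    using assms(1) by (simp add: rational_vector_space_def)
  obtain B where B: "countable B" "infinite B" "independent B" "span B = UNIV"
    using assms(2) unfolding countably_infinite_dim_def by blast
  obtain v where "v \<in> B" using B(2) by fastforce
  then have "v \<noteq> 0" using B(3) dependent_zero by blast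
  moreover have "countable (UNIV :: 'v set)" using countable_span[OF B(1)] B(4) by simp
  ultimately show ?thesis
    using midpoint_age_indivisible midpoint_not_weakly_indivisible midpoint_universal[OF B(2,3)]
    by blast
qed

end
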